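(* Let $L>0$ and $M\in\mathbb R$, let $f\in\mathcal F_L(\mathbb R^n)$ satisfy $f^*\le M$, and let $(x_k)_{k\in\mathbb N}$ be the trajectory of gradient descent $x_{k+1}:=x_k-\frac1L\nabla f(x_k)$ with initial point $x_0:=0$. Let $p^\star$ be the minimum-norm point of $\overline{\operatorname{dom} f^*}$. Then: (a) For all $k\ge1$, $\|\nabla f(x_k)-p^\star\|^2\le\|\nabla f(x_k)\|^2-\|p^\star\|^2\le\frac{2L(M+f(0))}{k}$. (b) If $\|\nabla f(x_k)\|^2>\frac{2L(M+f(0))}{k}$ for some $k\ge1$, then $f$ is lower-unbounded, i.e. $\inf_{x\in\mathbb R^n}f(x)=-\infty$. (c) If $p^\star\ne0$, the inequality $\|\nabla f(x_k)\|^2>\frac{2L(M+f(0))}{k}$ holds for all integers $k>\frac{2L(M+f(0))}{\|p^\star\|^2}$.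
   Context: $\|\cdot\|$ and $\langle\cdot,\cdot\rangle$ are the Euclidean norm and inner product on $\mathbb R^n$. For $L>0$, $\mathcal F_L(\mathbb R^n)$ is the set of finite-valued differentiable convex functions $f:\mathbb R^n\to\mathbb R$ whose gradient is $L$-Lipschitz. The Legendre--Fenchel conjugate is $f^*(p):=\sup_{x\in\mathbb R^n}\{\langle p,x\rangle-f(x)\}\in\mathbb R\cup\{\infty\}$, and $\operatorname{dom} f^*:=\{p\in\mathbb R^n: f^*(p)<\infty\}$; it is a nonempty convex set, so its closure has a unique minimum-norm point. The notation $f^*\le M$ means $f^*(p)\le M$ for all $p\in\operatorname{dom} f^*$. *)

theory Defs
  imports "HOL-Analysis.Analysis"
begin

definition gradient :: "('a::euclidean_space \<Rightarrow> real) \<Rightarrow> 'a \<Rightarrow> 'a" where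
  "gradient f x = (THE D. GDERIV f x :> D)"

lemma gradient_eqI:
  assumes "GDERIV f x :> D"
  shows "gradient f x = D"
  unfolding gradient_def
proof (rule the_equality)
  fix E assume "GDERIV f x :> E"
  from this assms have "(\<lambda>h. inner h E) = (\<lambda>h. inner h D)"
    unfolding gderiv_def by (rule has_derivative_unique)
  then show "E = D"
    by (metis vector_eq_ldot inner_commute)
qed (fact assms)

lemma GDERIV_gradient:
  assumes "f differentiable (at x)"
  shows "GDERIV f x :> gradient f x"
proof -
  obtain f' where f': "(f has_derivative f') (at x)"
    using assms by (auto simp: differentiable_def)
  then interpret bounded_linear f'
    by (rule has_derivative_bounded_linear)
  have "f' = (\<lambda>h. inner h (adjoint f' 1))"
    using adjoint_works[OF linear_axioms, of _ 1] by (simp add: fun_eq_iff inner_commute)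
  with f' have "GDERIV f x :> adjoint f' 1"
    by (simp add: gderiv_def)
  with gradient_eqI show ?thesis by metis
qed

definition smooth_convex :: "real \<Rightarrow> ('a::euclidean_space \<Rightarrow> real) set" where
  "smooth_convex L = {f. convex_on UNIV f \<and> f differentiable_on UNIV
     \<and> L-lipschitz_on UNIV (gradient f)}"

definition fenchel_conjugate :: "('a::euclidean_space \<Rightarrow> real) \<Rightarrow> 'a \<Rightarrow> ereal" where
  "fenchel_conjugate f p = (SUP x. ereal (inner p x - f x))"

definition conjugate_dom :: "('a::euclidean_space \<Rightarrow> real) \<Rightarrow> 'a set" where
  "conjugate_dom f = {p. fenchel_conjugate f p < \<infinity>}"

end

theory Submission
  imports Defs
begin

text \<open>
  For \<open>q\<close> in the domain of the conjugate, the energy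
  \<open>k \<parallel>\<nabla>f(x\<^sub>k)\<parallel>\<^sup>2 / (2L) + f(x\<^sub>k) - \<langle>q, x\<^sub>k\<rangle>\<close>
  grows by at most \<open>\<parallel>q\<parallel>\<^sup>2 / (2L)\<close> per step: cocoercivity makes the gradient norms
  nonincreasing and gives a decrease of \<open>f\<close> by at least
  \<open>(\<parallel>\<nabla>f(x\<^sub>k)\<parallel>\<^sup>2 + \<parallel>\<nabla>f(x\<^sub>k\<^sub>+\<^sub>1)\<parallel>\<^sup>2) / (2L)\<close>.
  As \<open>f(x\<^sub>k) - \<langle>q, x\<^sub>k\<rangle> \<ge> -M\<close>, this bounds
  \<open>\<parallel>\<nabla>f(x\<^sub>k)\<parallel>\<^sup>2 - \<parallel>q\<parallel>\<^sup>2\<close>, and the bound passes to the closure.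
  All gradients lie in the domain, so the projection inequality at the minimum-norm point
  gives the rest of (a); if \<open>f\<close> is bounded below then \<open>0\<close> lies in the domain and
  the minimum-norm point is \<open>0\<close>, which gives (b).
\<close>

section \<open>Inequalities for convex functions with Lipschitz gradient\<close>

lemma smooth_convex_has_gradient:
  assumes "f \<in> smooth_convex L"
  shows "GDERIV f x :> gradient f x"
  using assms by (intro GDERIV_gradient) (auto simp: smooth_convex_def differentiable_on_def)

lemma smooth_convex_lipschitz:
  assumes "f \<in> smooth_convex L"
  shows "norm (gradient f x - gradient f y) \<le> L * norm (x - y)"
  using assms by (auto simp: smooth_convex_def lipschitz_on_def dist_norm)

lemma GDERIV_along_line:
  fixes f :: "'a::real_inner \<Rightarrow> real"
  assumes "GDERIV f (x + t *\<^sub>R d) :> D"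
  shows "((\<lambda>t. f (x + t *\<^sub>R d)) has_real_derivative inner d D) (at t)"
proof -
  have "((\<lambda>t. x + t *\<^sub>R d) has_derivative (\<lambda>h. h *\<^sub>R d)) (at t)"
    by (auto intro!: derivative_eq_intros)
  from has_derivative_compose[OF this, of f "\<lambda>h. inner h D"] assms
  have "((\<lambda>t. f (x + t *\<^sub>R d)) has_derivative (\<lambda>h. inner (h *\<^sub>R d) D)) (at t)"
    by (simp add: gderiv_def)
  moreover have "(\<lambda>h. inner (h *\<^sub>R d) D) = (*) (inner d D)"
    by (simp add: fun_eq_iff mult.commute)
  ultimately show ?thesis
    by (simp add: has_field_derivative_def)
qed

text \<open>Restricting to the line through \<open>x\<close> and \<open>y\<close> reduces this to
  the tangent inequality for convex functions of one real variable.\<close>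

lemma smooth_convex_above_tangent:
  assumes "f \<in> smooth_convex L"
  shows "f x + inner (gradient f x) (y - x) \<le> f y"
proof -
  define h where "h t = f (x + t *\<^sub>R (y - x))" for t :: real
  have cf: "convex_on UNIV f" using assms by (simp add: smooth_convex_def)
  have cv: "convex_on UNIV h"
  proof (rule convex_onI)
    fix t a b :: real assume t: "0 < t" "t < 1"
    have "x + ((1 - t) *\<^sub>R a + t *\<^sub>R b) *\<^sub>R (y - x)
        = (1 - t) *\<^sub>R (x + a *\<^sub>R (y - x)) + t *\<^sub>R (x + b *\<^sub>R (y - x))"
      by (simp add: algebra_simps)
    with convex_onD[OF cf, of t "x + a *\<^sub>R (y - x)" "x + b *\<^sub>R (y - x)"] t
    show "h ((1 - t) *\<^sub>R a + t *\<^sub>R b) \<le> (1 - t) * h a + t * h b"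
      by (simp add: h_def)
  qed simp
  have d: "(h has_real_derivative inner (y - x) (gradient f x)) (at 0)"
    unfolding h_def using smooth_convex_has_gradient[OF assms] by (intro GDERIV_along_line) simp
  show ?thesis
    using convex_on_imp_above_tangent[OF cv _ _ _ d, of 1] by (simp add: h_def inner_commute)
qed

lemma smooth_convex_descent:
  assumes "f \<in> smooth_convex L"
  shows "f y \<le> f x + inner (gradient f x) (y - x) + L / 2 * (norm (y - x))\<^sup>2"
proof -
  define d where "d = y - x"
  \<comment> \<open>Chosen so that \<open>h 1 \<le> h 0\<close> is the claim; Cauchy-Schwarz and the
    Lipschitz bound make its derivative nonpositive on [0, 1].\<close>
  define h where "h t = f (x + t *\<^sub>R d) - t * inner (gradient f x) d - t\<^sup>2 * (L / 2 * (norm d)\<^sup>2)"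
    for t :: real
  have "h 1 \<le> h 0"
  proof (rule DERIV_nonpos_imp_nonincreasing[of 0 1 h])
    fix t :: real assume t: "0 \<le> t" "t \<le> 1"
    let ?D = "inner d (gradient f (x + t *\<^sub>R d)) - inner (gradient f x) d - 2 * t * (L / 2 * (norm d)\<^sup>2)"
    have "(h has_real_derivative ?D) (at t)"
      unfolding h_def
      by (auto intro!: derivative_eq_intros GDERIV_along_line smooth_convex_has_gradient[OF assms])
    moreover have "?D \<le> 0"
    proof -
      have "inner d (gradient f (x + t *\<^sub>R d)) - inner (gradient f x) d
          = inner (gradient f (x + t *\<^sub>R d) - gradient f x) d"
        by (simp add: inner_diff_left inner_diff_right inner_commute)
      also have "\<dots> \<le> norm (gradient f (x + t *\<^sub>R d) - gradient f x) * norm d"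
        by (rule norm_cauchy_schwarz)
      also have "\<dots> \<le> (L * norm (t *\<^sub>R d)) * norm d"
        using smooth_convex_lipschitz[OF assms, of "x + t *\<^sub>R d" x]
        by (intro mult_right_mono) auto
      also have "\<dots> = 2 * t * (L / 2 * (norm d)\<^sup>2)"
        using t by (simp add: power2_eq_square)
      finally show ?thesis by simp
    qed
    ultimately show "\<exists>D. (h has_real_derivative D) (at t) \<and> D \<le> 0" by blast
  qed simp
  then show ?thesis by (simp add: h_def d_def)
qed

text \<open>The tilted function \<open>f - \<langle>\<nabla>f(x), \<cdot>\<rangle>\<close> is minimal at \<open>x\<close>; compare its value there
  with its value after one gradient step from \<open>y\<close>.\<close>
lemma smooth_convex_cocoercive:
  assumes "f \<in> smooth_convex L" and "L > 0"
  shows "f x + inner (gradient f x) (y - x) + (norm (gradient f y - gradient f x))\<^sup>2 / (2 * L) \<le> f y"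
proof -
  define u where "u = gradient f y - gradient f x"
  define z where "z = y - (1 / L) *\<^sub>R u"
  have "f x + inner (gradient f x) (z - x) \<le> f z"
    by (rule smooth_convex_above_tangent[OF assms(1)])
  also have "f z \<le> f y + inner (gradient f y) (z - y) + L / 2 * (norm (z - y))\<^sup>2"
    by (rule smooth_convex_descent[OF assms(1)])
  also have "L / 2 * (norm (z - y))\<^sup>2 = inner u u / (2 * L)"
    using assms(2) by (simp add: z_def power_divide power2_norm_eq_inner power2_eq_square[of L])
  finally have "f x + inner (gradient f x) (y - x) + inner u u / L \<le> f y + inner u u / (2 * L)"
    by (simp add: z_def u_def algebra_simps inner_diff_left diff_divide_distrib add_divide_distrib)
  moreover have "inner u u / L = 2 * (inner u u / (2 * L))" by simp
  ultimately show ?thesis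
    unfolding u_def[symmetric] power2_norm_eq_inner by linarith
qed

section \<open>Gradient steps and the energy estimate\<close>

lemma gradient_step_norm_antimono:
  assumes "f \<in> smooth_convex L" and "L > 0"
  shows "norm (gradient f (x - (1 / L) *\<^sub>R gradient f x)) \<le> norm (gradient f x)"
proof -
  define y where "y = x - (1 / L) *\<^sub>R gradient f x"
  define a where "a = gradient f x"
  define b where "b = gradient f y"
  \<comment> \<open>Adding cocoercivity in both directions cancels the values of \<open>f\<close>;
    substituting \<open>x - y = a / L\<close> then leaves only \<open>a\<close> and
    \<open>b\<close>.\<close>
  have "inner a (y - x) + inner b (x - y) + 2 * ((norm (b - a))\<^sup>2 / (2 * L)) \<le> 0"
    using smooth_convex_cocoercive[OF assms, of x y] smooth_convex_cocoercive[OF assms, of y x]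
    by (simp add: a_def b_def norm_minus_commute)
  then have "(inner b a - inner a a + (norm (b - a))\<^sup>2) / L \<le> 0"
    by (simp add: y_def a_def[symmetric] add_divide_distrib diff_divide_distrib)
  then have "inner b a - inner a a + (norm (b - a))\<^sup>2 \<le> 0"
    using assms(2) by (simp add: divide_le_0_iff)
  then have "inner b b \<le> inner b a"
    by (simp add: power2_norm_eq_inner inner_diff_left inner_diff_right inner_commute)
  also have "\<dots> \<le> norm b * norm a" by (rule norm_cauchy_schwarz)
  finally have "norm b * norm b \<le> norm b * norm a"
    by (simp add: power2_norm_eq_inner[symmetric] power2_eq_square)
  then have "norm b \<le> norm a"
    by (metis mult_le_cancel_left_pos norm_ge_zero order_le_less)
  then show ?thesis by (simp add: a_def b_def y_def)
qed

text \<open>Cocoercivity based at the new point \<open>y\<close>: its linear term equals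
  \<open>inner a b / L\<close> and cancels the cross term of the square.\<close>

lemma gradient_step_decrease:
  fixes x :: "'a::euclidean_space"
  assumes "f \<in> smooth_convex L" and "L > 0"
  defines "y \<equiv> x - (1 / L) *\<^sub>R gradient f x"
  shows "f y + ((norm (gradient f x))\<^sup>2 + (norm (gradient f y))\<^sup>2) / (2 * L) \<le> f x"
proof -
  define a where "a = gradient f x"
  define b where "b = gradient f y"
  have "f y + inner b (x - y) + (norm (a - b))\<^sup>2 / (2 * L) \<le> f x"
    unfolding a_def b_def by (rule smooth_convex_cocoercive[OF assms(1,2)])
  moreover have "inner b (x - y) = inner a b / L"
    by (simp add: y_def a_def[symmetric] inner_commute)
  moreover have "(norm (a - b))\<^sup>2 / (2 * L) = ((norm a)\<^sup>2 + (norm b)\<^sup>2) / (2 * L) - inner a b / L"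
    using assms(2) by (simp add: power2_norm_eq_inner inner_diff_left inner_diff_right
        inner_commute[of b a] field_simps)
  ultimately have "f y + ((norm a)\<^sup>2 + (norm b)\<^sup>2) / (2 * L) \<le> f x" by linarith
  then show ?thesis by (simp add: a_def b_def)
qed

lemma gradient_descent_energy:
  assumes "f \<in> smooth_convex L" and "L > 0"
    and step: "\<And>k. x (Suc k) = x k - (1 / L) *\<^sub>R gradient f (x k)"
  shows "real k * (norm (gradient f (x k)))\<^sup>2 / (2 * L) + f (x k) - inner q (x k)
       \<le> f (x 0) - inner q (x 0) + real k * (norm q)\<^sup>2 / (2 * L)"
proof (induction k)
  case 0
  show ?case by simp
next
  case (Suc k)
  define a where "a = gradient f (x k)"
  define b where "b = gradient f (x (Suc k))"
  have "(norm b)\<^sup>2 \<le> (norm a)\<^sup>2"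
    using gradient_step_norm_antimono[OF assms(1,2), of "x k"]
    by (simp add: a_def b_def step power_mono)
  then have mono: "real k * (norm b)\<^sup>2 / (2 * L) \<le> real k * (norm a)\<^sup>2 / (2 * L)"
    using assms(2) by (intro divide_right_mono mult_left_mono) auto
  have dec: "f (x (Suc k)) + ((norm a)\<^sup>2 + (norm b)\<^sup>2) / (2 * L) \<le> f (x k)"
    using gradient_step_decrease[OF assms(1,2), of "x k"] by (simp add: a_def b_def step)
  \<comment> \<open>The new term \<open>(norm b)\<^sup>2 / (2 * L)\<close> is absorbed by
    \<open>dec\<close>. What remains is \<open>inner q a / L - (norm a)\<^sup>2 / (2 * L)\<close>,
    which this square bounds by the allowed growth.\<close>
  have "0 \<le> (norm (a - q))\<^sup>2 / (2 * L)" using assms(2) by simp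
  also have "\<dots> = (norm a)\<^sup>2 / (2 * L) - inner q a / L + (norm q)\<^sup>2 / (2 * L)"
    by (simp add: power2_norm_eq_inner inner_diff_left inner_diff_right inner_commute[of a q]
        add_divide_distrib diff_divide_distrib)
  finally have sq: "inner q a / L \<le> (norm a)\<^sup>2 / (2 * L) + (norm q)\<^sup>2 / (2 * L)" by simp
  have inner_step: "inner q (x (Suc k)) = inner q (x k) - inner q a / L"
    by (simp add: step a_def inner_diff_right)
  have split: "real (Suc k) * c / (2 * L) = real k * c / (2 * L) + c / (2 * L)" for c
    by (simp add: distrib_right add_divide_distrib)
  show ?case
    unfolding b_def[symmetric] split
    using inner_step mono dec[unfolded add_divide_distrib] sq Suc.IH[folded a_def] by linarith
qed

section \<open>The domain of the conjugate\<close>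

lemma conjugate_dom_iff: "q \<in> conjugate_dom f \<longleftrightarrow> (\<exists>B. \<forall>y. inner q y - f y \<le> B)"
proof
  assume "q \<in> conjugate_dom f"
  then have *: "fenchel_conjugate f q < \<infinity>" by (simp add: conjugate_dom_def)
  have up: "ereal (inner q y - f y) \<le> fenchel_conjugate f q" for y
    unfolding fenchel_conjugate_def by (rule SUP_upper) simp
  with * show "\<exists>B. \<forall>y. inner q y - f y \<le> B"
    by (cases "fenchel_conjugate f q") auto
next
  assume "\<exists>B. \<forall>y. inner q y - f y \<le> B"
  then obtain B where "\<And>y. inner q y - f y \<le> B" by blast
  then have "fenchel_conjugate f q \<le> ereal B"
    unfolding fenchel_conjugate_def by (intro SUP_least) simp
  then show "q \<in> conjugate_dom f"
    by (auto simp: conjugate_dom_def)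
qed

lemma convex_conjugate_dom: "convex (conjugate_dom f)"
proof (rule convexI)
  fix p q and u v :: real
  assume pq: "p \<in> conjugate_dom f" "q \<in> conjugate_dom f" and uv: "0 \<le> u" "0 \<le> v" "u + v = 1"
  then obtain B C where B: "\<And>y. inner p y - f y \<le> B" and C: "\<And>y. inner q y - f y \<le> C"
    unfolding conjugate_dom_iff by blast
  have "inner (u *\<^sub>R p + v *\<^sub>R q) y - f y \<le> u * B + v * C" for y
  proof -
    have "f y = u * f y + v * f y"
      using uv(3) by (metis distrib_right mult_1)
    then have "inner (u *\<^sub>R p + v *\<^sub>R q) y - f y = u * (inner p y - f y) + v * (inner q y - f y)"
      by (simp add: inner_add_left right_diff_distrib)
    also have "\<dots> \<le> u * B + v * C"
      using B C uv by (intro add_mono mult_left_mono) auto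
    finally show ?thesis .
  qed
  then show "u *\<^sub>R p + v *\<^sub>R q \<in> conjugate_dom f"
    unfolding conjugate_dom_iff by blast
qed

text \<open>By the tangent inequality the supremum defining the conjugate is attained at
  \<open>x\<close>.\<close>

lemma gradient_in_conjugate_dom:
  assumes "f \<in> smooth_convex L"
  shows "gradient f x \<in> conjugate_dom f"
  unfolding conjugate_dom_iff
proof (intro exI allI)
  fix y
  show "inner (gradient f x) y - f y \<le> inner (gradient f x) x - f x"
    using smooth_convex_above_tangent[OF assms, of x y] by (simp add: inner_diff_right)
qed

text \<open>The conjugate at 0 is the negative of the infimum of \<open>f\<close>.\<close>

lemma zero_in_conjugate_dom:
  assumes "(INF y. ereal (f y)) \<noteq> -\<infinity>"
  shows "0 \<in> conjugate_dom f"
proof -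
  have "(INF y. ereal (f y)) \<le> ereal (f z)" for z by (rule INF_lower) simp
  with assms obtain B where "\<And>y. ereal B \<le> ereal (f y)"
    by (cases "INF y. ereal (f y)") auto
  then have "\<forall>y. inner 0 y - f y \<le> - B" by simp
  then show ?thesis unfolding conjugate_dom_iff by blast
qed

text \<open>\<open>arg_min_on\<close> is a choice operator, so its properties rest on the existence
  of a minimiser, which closedness supplies.\<close>

lemma arg_min_on_norm_closed:
  fixes S :: "'a::euclidean_space set"
  assumes "closed S" and "S \<noteq> {}"
  shows "arg_min_on norm S \<in> S" and "y \<in> S \<Longrightarrow> norm (arg_min_on norm S) \<le> norm y"
proof -
  obtain z where "z \<in> S" "\<And>y. y \<in> S \<Longrightarrow> dist 0 z \<le> dist 0 y"
    using distance_attains_inf[OF assms, of 0] by blast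
  then have "is_arg_min norm (\<lambda>y. y \<in> S) z"
    by (auto simp: is_arg_min_linorder)
  then have "is_arg_min norm (\<lambda>y. y \<in> S) (arg_min_on norm S)"
    unfolding arg_min_on_def arg_min_def by (rule someI)
  then show "arg_min_on norm S \<in> S" and "y \<in> S \<Longrightarrow> norm (arg_min_on norm S) \<le> norm y"
    by (auto simp: is_arg_min_linorder)
qed

theorem corollary3p8:
  fixes f :: "real ^ 'n \<Rightarrow> real" and L M :: real
    and x :: "nat \<Rightarrow> real ^ 'n" and p :: "real ^ 'n"
  assumes L_pos: "L > 0"
    and f_class: "f \<in> smooth_convex L"
    and conj_le: "\<forall>q\<in>conjugate_dom f. fenchel_conjugate f q \<le> ereal M"
    and x_0: "x 0 = 0"
    and x_Suc: "\<forall>k. x (Suc k) = x k - (1 / L) *\<^sub>R gradient f (x k)"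
    and p_min: "p = arg_min_on norm (closure (conjugate_dom f))"
  shows "(\<forall>k\<ge>1. (norm (gradient f (x k) - p))\<^sup>2 \<le> (norm (gradient f (x k)))\<^sup>2 - (norm p)\<^sup>2
             \<and> (norm (gradient f (x k)))\<^sup>2 - (norm p)\<^sup>2 \<le> 2 * L * (M + f 0) / real k)
       \<and> ((\<exists>k\<ge>1. (norm (gradient f (x k)))\<^sup>2 > 2 * L * (M + f 0) / real k)
             \<longrightarrow> (INF y. ereal (f y)) = -\<infinity>)
       \<and> (p \<noteq> 0 \<longrightarrow> (\<forall>k::nat. real k > 2 * L * (M + f 0) / (norm p)\<^sup>2
             \<longrightarrow> (norm (gradient f (x k)))\<^sup>2 > 2 * L * (M + f 0) / real k))"
proof -
  let ?C = "closure (conjugate_dom f)"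
  let ?g = "\<lambda>k. gradient f (x k)"
  have dom: "?g k \<in> conjugate_dom f" for k
    by (rule gradient_in_conjugate_dom[OF f_class])
  have in_C: "?g k \<in> ?C" for k
    using dom closure_subset by blast
  have p_C: "p \<in> ?C" and p_le: "\<And>y. y \<in> ?C \<Longrightarrow> norm p \<le> norm y"
    unfolding p_min using in_C by (auto intro!: arg_min_on_norm_closed)
  have conj: "inner q y - f y \<le> M" if "q \<in> conjugate_dom f" for q y
  proof -
    have "ereal (inner q y - f y) \<le> fenchel_conjugate f q"
      unfolding fenchel_conjugate_def by (rule SUP_upper) simp
    also have "\<dots> \<le> ereal M" using conj_le that by blast
    finally show ?thesis by simp
  qed
  have M_f0: "0 \<le> M + f 0" using conj[OF dom, of 0 0] by simp
  have a1: "(norm (?g k - p))\<^sup>2 \<le> (norm (?g k))\<^sup>2 - (norm p)\<^sup>2" for k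
  proof -
    \<comment> \<open>\<open>p\<close> is the point of the convex set \<open>?C\<close> closest to
      0. Expanded, this reads \<open>(norm p)\<^sup>2 \<le> inner p (?g k)\<close>.\<close>
    have "inner (0 - p) (?g k - p) \<le> 0"
      using convex_closure[OF convex_conjugate_dom] p_le
      by (intro any_closest_point_dot[OF _ _ p_C in_C]) auto
    then show ?thesis
      by (simp add: power2_norm_eq_inner inner_diff_left inner_diff_right inner_commute)
  qed
  have a2: "(norm (?g k))\<^sup>2 - (norm p)\<^sup>2 \<le> 2 * L * (M + f 0) / real k" if "k \<ge> 1" for k
  proof -
    \<comment> \<open>\<open>p\<close> may lie outside \<open>conjugate_dom f\<close>, where
      \<open>conj\<close> says nothing, so the bound is proved on the domain and extended by
      closedness.\<close>
    let ?S = "{q. (norm (?g k))\<^sup>2 - (norm q)\<^sup>2 \<le> 2 * L * (M + f 0) / real k}"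
    have "conjugate_dom f \<subseteq> ?S"
    proof
      fix q assume q: "q \<in> conjugate_dom f"
      have "real k * (norm (?g k))\<^sup>2 / (2 * L) + f (x k) - inner q (x k)
          \<le> f 0 + real k * (norm q)\<^sup>2 / (2 * L)"
        using gradient_descent_energy[OF f_class L_pos, of x k q] x_Suc x_0 by simp
      with conj[OF q, of "x k"]
      have "real k * (norm (?g k))\<^sup>2 / (2 * L) - real k * (norm q)\<^sup>2 / (2 * L) \<le> M + f 0"
        by linarith
      then show "q \<in> ?S"
        using L_pos that by (simp add: field_simps)
    qed
    moreover have "closed ?S"
      by (intro closed_Collect_le continuous_intros)
    ultimately show ?thesis
      using closure_minimal p_C by blast
  qed
  have b: "(INF y. ereal (f y)) = -\<infinity>"
    if "k \<ge> 1" "(norm (?g k))\<^sup>2 > 2 * L * (M + f 0) / real k" for k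
  proof (rule ccontr)
    assume "(INF y. ereal (f y)) \<noteq> -\<infinity>"
    then have "0 \<in> ?C" using zero_in_conjugate_dom closure_subset by blast
    then have "p = 0" using p_le by fastforce
    with a2[OF that(1)] that(2) show False by simp
  qed
  have c: "(norm (?g k))\<^sup>2 > 2 * L * (M + f 0) / real k"
    if "p \<noteq> 0" and k: "real k > 2 * L * (M + f 0) / (norm p)\<^sup>2" for k
  proof -
    \<comment> \<open>A nonnegative threshold excludes \<open>k = 0\<close>, so that multiplying by
      \<open>real k\<close> is legitimate.\<close>
    have "0 \<le> 2 * L * (M + f 0) / (norm p)\<^sup>2" using L_pos M_f0 by simp
    with k have "real k > 0" by linarith
    then have "2 * L * (M + f 0) / real k < (norm p)\<^sup>2"
      using k that(1) by (simp add: field_simps)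
    also have "\<dots> \<le> (norm (?g k))\<^sup>2" using p_le[OF in_C] by (simp add: power_mono)
    finally show ?thesis .
  qed
  from a1 a2 b c show ?thesis by blast
qed

end
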